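(* Let $n\geq 0$ be fixed and let $0\leq k\leq n$. Then, for every integer $j\ge 0$ and every $q\in\mathbb{H}$ with real part $x_0$, $$\mathcal{C}_{n+1}(\overline{q}^k q^j)=\begin{cases}0 & \text{if } j=0,1,\\ -2(j-1)j\,x_0^k\,Q_{j-2}(q,\overline{q}) & \text{if } j\geq 2.\end{cases}$$
   Context: $\mathbb{H}$ is the algebra of real quaternions $q=x_0+x_1i+x_2j+x_3k$, with conjugate $\overline q$; $\mathbb{S}=\{q\in\mathbb{H}:q^2=-1\}$ is the sphere of imaginary units, $\mathbb{C}_I=\mathbb{R}+\mathbb{R}I$ for $I\in\mathbb{S}$, and $\Delta=\partial_{x_0}^2+\partial_{x_1}^2+\partial_{x_2}^2+\partial_{x_3}^2$. A slice function on an axially symmetric set is a function of the form $f(x+Iy)=\alpha(x,y)+I\beta(x,y)$, $I\in\mathbb S$, with $\alpha,\beta$ quaternion-valued, $\alpha$ even and $\beta$ odd in $y$. A $\mathcal{C}^{n+1}$ slice function $f$ is (left) slice polyanalytic of order $n+1$ if $\frac{1}{2^{n+1}}(\partial_x+I\partial_y)^{n+1}f(x+Iy)=0$ for all $I\in\mathbb{S}$; slice hyperholomorphic means order $1$. On an axially symmetric slice domain $\Omega$ (a domain meeting the real line, whose intersection with each $\mathbb C_I$ is a domain, and which contains the sphere $x+y\mathbb{S}$ whenever it contains $x+Iy$), $f$ is slice polyanalytic of order $n+1$ iff $f(q)=\sum_{k=0}^n\overline q^kf_k(q)$ with unique slice hyperholomorphic $f_0,\dots,f_n$. The polyanalytic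 Fueter map $\mathcal{C}_{n+1}$ is defined by $$\mathcal{C}_{n+1}(f)(q)=\sum_{k=0}^n x_0^k\,\Delta f_k(q).$$ $Q_s(q,\overline q)=\sum_{j=0}^s\frac{2(s-j+1)}{(s+1)(s+2)}q^{s-j}\overline q^{\,j}$ for $s\ge 0$. *)

theory Defs
  imports "HOL-Analysis.Analysis"
begin

section \<open>Real quaternions\<close>

text \<open>\<open>Quat a b c d\<close> is $a + bi + cj + dk$.\<close>

datatype quat = Quat (qRe: real) (qIm1: real) (qIm2: real) (qIm3: real)

lemma quat_eq_iff:
  "p = q \<longleftrightarrow> qRe p = qRe q \<and> qIm1 p = qIm1 q \<and> qIm2 p = qIm2 q \<and> qIm3 p = qIm3 q"
  by (cases p; cases q) simp

instantiation quat :: ring_1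
begin

definition zero_quat :: quat where "0 = Quat 0 0 0 0"

definition one_quat :: quat where "1 = Quat 1 0 0 0"

definition plus_quat :: "quat \<Rightarrow> quat \<Rightarrow> quat" where
  "p + q = Quat (qRe p + qRe q) (qIm1 p + qIm1 q) (qIm2 p + qIm2 q) (qIm3 p + qIm3 q)"

definition uminus_quat :: "quat \<Rightarrow> quat" where
  "- q = Quat (- qRe q) (- qIm1 q) (- qIm2 q) (- qIm3 q)"

definition minus_quat :: "quat \<Rightarrow> quat \<Rightarrow> quat" where
  "p - q = Quat (qRe p - qRe q) (qIm1 p - qIm1 q) (qIm2 p - qIm2 q) (qIm3 p - qIm3 q)"

definition times_quat :: "quat \<Rightarrow> quat \<Rightarrow> quat" where
  "p * q = Quat
     (qRe p * qRe q - qIm1 p * qIm1 q - qIm2 p * qIm2 q - qIm3 p * qIm3 q)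
     (qRe p * qIm1 q + qIm1 p * qRe q + qIm2 p * qIm3 q - qIm3 p * qIm2 q)
     (qRe p * qIm2 q - qIm1 p * qIm3 q + qIm2 p * qRe q + qIm3 p * qIm1 q)
     (qRe p * qIm3 q + qIm1 p * qIm2 q - qIm2 p * qIm1 q + qIm3 p * qRe q)"

instance
  by standard
    (simp_all add: zero_quat_def one_quat_def plus_quat_def uminus_quat_def minus_quat_def
      times_quat_def algebra_simps)

end

lemma quat_sel_zero [simp]: "qRe 0 = 0" "qIm1 0 = 0" "qIm2 0 = 0" "qIm3 0 = 0"
  by (simp_all add: zero_quat_def)

lemma quat_sel_one [simp]: "qRe 1 = 1" "qIm1 1 = 0" "qIm2 1 = 0" "qIm3 1 = 0"
  by (simp_all add: one_quat_def)

lemma quat_sel_add [simp]: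
  "qRe (p + q) = qRe p + qRe q" "qIm1 (p + q) = qIm1 p + qIm1 q"
  "qIm2 (p + q) = qIm2 p + qIm2 q" "qIm3 (p + q) = qIm3 p + qIm3 q"
  by (simp_all add: plus_quat_def)

lemma quat_sel_uminus [simp]:
  "qRe (- q) = - qRe q" "qIm1 (- q) = - qIm1 q" "qIm2 (- q) = - qIm2 q" "qIm3 (- q) = - qIm3 q"
  by (simp_all add: uminus_quat_def)

lemma quat_sel_diff [simp]:
  "qRe (p - q) = qRe p - qRe q" "qIm1 (p - q) = qIm1 p - qIm1 q"
  "qIm2 (p - q) = qIm2 p - qIm2 q" "qIm3 (p - q) = qIm3 p - qIm3 q"
  by (simp_all add: minus_quat_def)

lemma quat_sel_mult [simp]:
  "qRe (p * q) = qRe p * qRe q - qIm1 p * qIm1 q - qIm2 p * qIm2 q - qIm3 p * qIm3 q"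
  "qIm1 (p * q) = qRe p * qIm1 q + qIm1 p * qRe q + qIm2 p * qIm3 q - qIm3 p * qIm2 q"
  "qIm2 (p * q) = qRe p * qIm2 q - qIm1 p * qIm3 q + qIm2 p * qRe q + qIm3 p * qIm1 q"
  "qIm3 (p * q) = qRe p * qIm3 q + qIm1 p * qIm2 q - qIm2 p * qIm1 q + qIm3 p * qRe q"
  by (simp_all add: times_quat_def)

instantiation quat :: real_algebra_1
begin

definition scaleR_quat :: "real \<Rightarrow> quat \<Rightarrow> quat" where
  "c *\<^sub>R q = Quat (c * qRe q) (c * qIm1 q) (c * qIm2 q) (c * qIm3 q)"

instance
  by standard (simp_all add: scaleR_quat_def quat_eq_iff algebra_simps)

end

lemma quat_sel_scaleR [simp]:
  "qRe (c *\<^sub>R q) = c * qRe q" "qIm1 (c *\<^sub>R q) = c * qIm1 q"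
  "qIm2 (c *\<^sub>R q) = c * qIm2 q" "qIm3 (c *\<^sub>R q) = c * qIm3 q"
  by (simp_all add: scaleR_quat_def)

instantiation quat :: real_normed_vector
begin

definition norm_quat :: "quat \<Rightarrow> real" where
  "norm q = sqrt ((qRe q)\<^sup>2 + (qIm1 q)\<^sup>2 + (qIm2 q)\<^sup>2 + (qIm3 q)\<^sup>2)"

definition sgn_quat :: "quat \<Rightarrow> quat" where "sgn (q :: quat) = inverse (norm q) *\<^sub>R q"

definition dist_quat :: "quat \<Rightarrow> quat \<Rightarrow> real" where "dist (p :: quat) q = norm (p - q)"

definition uniformity_quat :: "(quat \<times> quat) filter" where
  "uniformity = (INF e\<in>{0 <..}. principal {(p :: quat, q). dist p q < e})"

definition open_quat :: "quat set \<Rightarrow> bool" where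
  "open (U :: quat set) \<longleftrightarrow> (\<forall>p\<in>U. eventually (\<lambda>(p', q). p' = p \<longrightarrow> q \<in> U) uniformity)"

instance
proof
  fix p q :: quat and c :: real
  let ?t = "\<lambda>q. (qRe q, qIm1 q, qIm2 q, qIm3 q)"
  have n: "norm q = norm (?t q)" for q
    by (simp add: norm_quat_def norm_Pair add.assoc)
  show "norm q = 0 \<longleftrightarrow> q = 0"
    by (simp add: n quat_eq_iff zero_prod_def)
  show "norm (p + q) \<le> norm p + norm q"
    using norm_triangle_ineq[of "?t p" "?t q"] by (simp add: n)
  show "norm (c *\<^sub>R q) = \<bar>c\<bar> * norm q"
    using norm_scaleR[of c "?t q"] by (simp add: n)
qed (auto simp: sgn_quat_def dist_quat_def uniformity_quat_def open_quat_def)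

end

instantiation quat :: real_inner
begin

definition inner_quat :: "quat \<Rightarrow> quat \<Rightarrow> real" where
  "inner p q = qRe p * qRe q + qIm1 p * qIm1 q + qIm2 p * qIm2 q + qIm3 p * qIm3 q"

instance
proof
  fix p q r :: quat and c :: real
  show "inner p q = inner q p"
    by (simp add: inner_quat_def mult.commute)
  show "inner (p + q) r = inner p r + inner q r"
    by (simp add: inner_quat_def distrib_right)
  show "inner (c *\<^sub>R p) q = c * inner p q"
    by (simp add: inner_quat_def distrib_left mult.assoc)
  show "norm q = sqrt (inner q q)"
    by (simp add: inner_quat_def norm_quat_def power2_eq_square)
  show "0 \<le> inner q q"
    by (simp add: inner_quat_def)
  show "inner q q = 0 \<longleftrightarrow> q = 0"
    by (simp add: inner_quat_def quat_eq_iff add_nonneg_eq_0_iff)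
qed

end

instance quat :: real_normed_algebra_1
proof
  fix p q :: quat
  have "inner (p * q) (p * q) = inner p p * inner q q"
    unfolding inner_quat_def quat_sel_mult by algebra
  then show "norm (p * q) \<le> norm p * norm q"
    by (simp add: norm_eq_sqrt_inner real_sqrt_mult)
  show "norm (1 :: quat) = 1"
    by (simp add: norm_quat_def)
qed

instantiation quat :: euclidean_space
begin

definition Basis_quat :: "quat set" where
  "Basis = {1, Quat 0 1 0 0, Quat 0 0 1 0, Quat 0 0 0 1}"

instance
proof
  fix q :: quat
  show "(\<forall>e\<in>Basis. inner q e = 0) \<longleftrightarrow> q = 0"
    by (cases q) (simp add: Basis_quat_def inner_quat_def zero_quat_def)
qed (auto simp: Basis_quat_def inner_quat_def one_quat_def)

end

definition qcnj :: "quat \<Rightarrow> quat" where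
  "qcnj q = Quat (qRe q) (- qIm1 q) (- qIm2 q) (- qIm3 q)"

definition imag_units :: "quat set" where
  "imag_units = {I. I\<^sup>2 = - 1}"


section \<open>Derivatives\<close>

definition dir_deriv ::
  "'a \<Rightarrow> ('a::real_normed_vector \<Rightarrow> 'b::real_normed_vector) \<Rightarrow> 'a \<Rightarrow> 'b" where
  "dir_deriv v f p = vector_derivative (\<lambda>t. f (p + t *\<^sub>R v)) (at 0)"

text \<open>\<open>Basis\<close> is the orthonormal basis $1, i, j, k$.\<close>

definition laplacian :: "(quat \<Rightarrow> quat) \<Rightarrow> quat \<Rightarrow> quat" where
  "laplacian f q = (\<Sum>e\<in>Basis. dir_deriv e (dir_deriv e f) q)"

text \<open>Class $C^m$ on an open set, in the real sense.\<close>

fun Ck_on :: "nat \<Rightarrow> 'a set \<Rightarrow> ('a::euclidean_space \<Rightarrow> 'b::real_normed_vector) \<Rightarrow> bool" where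
  "Ck_on 0 S f \<longleftrightarrow> continuous_on S f"
| "Ck_on (Suc m) S f \<longleftrightarrow>
     (\<forall>p\<in>S. f differentiable (at p)) \<and>
     (\<forall>v. Ck_on m S (\<lambda>p. frechet_derivative f (at p) v))"


section \<open>Slice polyanalytic functions\<close>

definition slice_pt :: "quat \<Rightarrow> real \<times> real \<Rightarrow> quat" where
  "slice_pt I = (\<lambda>(x, y). of_real x + I * of_real y)"

definition axially_symmetric :: "quat set \<Rightarrow> bool" where
  "axially_symmetric \<Omega> \<longleftrightarrow>
     (\<forall>x y. \<forall>I\<in>imag_units. slice_pt I (x, y) \<in> \<Omega> \<longrightarrow>
        (\<forall>J\<in>imag_units. slice_pt J (x, y) \<in> \<Omega>))"

text \<open>
  The intersection of \<open>\<Omega>\<close> with the plane of \<open>I\<close> is described through the coordinates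
  \<open>(x, y)\<close>; it is open because \<open>\<Omega>\<close> is, and nonempty because \<open>\<Omega>\<close> meets the real line.
\<close>

definition axially_symmetric_slice_domain :: "quat set \<Rightarrow> bool" where
  "axially_symmetric_slice_domain \<Omega> \<longleftrightarrow>
     open \<Omega> \<and> connected \<Omega> \<and> \<Omega> \<inter> range of_real \<noteq> {} \<and>
     (\<forall>I\<in>imag_units. connected (slice_pt I -` \<Omega>)) \<and> axially_symmetric \<Omega>"

lemma axially_symmetric_slice_domain_UNIV: "axially_symmetric_slice_domain UNIV"
  by (auto simp: axially_symmetric_slice_domain_def axially_symmetric_def)

definition slice_function :: "quat set \<Rightarrow> (quat \<Rightarrow> quat) \<Rightarrow> bool" where
  "slice_function \<Omega> f \<longleftrightarrow>
     (\<exists>\<alpha> \<beta> :: real \<Rightarrow> real \<Rightarrow> quat. \<forall>x y. \<forall>I\<in>imag_units. slice_pt I (x, y) \<in> \<Omega> \<longrightarrow>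
        \<alpha> x (- y) = \<alpha> x y \<and> \<beta> x (- y) = - \<beta> x y \<and>
        f (slice_pt I (x, y)) = \<alpha> x y + I * \<beta> x y)"

text \<open>$\partial_x + I\,\partial_y$ acting on functions of the coordinates \<open>(x, y)\<close>.\<close>

definition slice_dbar :: "quat \<Rightarrow> (real \<times> real \<Rightarrow> quat) \<Rightarrow> real \<times> real \<Rightarrow> quat" where
  "slice_dbar I g = (\<lambda>z. dir_deriv (1, 0) g z + I * dir_deriv (0, 1) g z)"

text \<open>The order \<open>m\<close> is meant to be positive.\<close>

definition slice_polyanalytic :: "nat \<Rightarrow> quat set \<Rightarrow> (quat \<Rightarrow> quat) \<Rightarrow> bool" where
  "slice_polyanalytic m \<Omega> f \<longleftrightarrow>
     slice_function \<Omega> f \<and> Ck_on m \<Omega> f \<and>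
     (\<forall>I\<in>imag_units. \<forall>z. slice_pt I z \<in> \<Omega> \<longrightarrow>
        (1 / 2 ^ m) *\<^sub>R (slice_dbar I ^^ m) (f \<circ> slice_pt I) z = 0)"

abbreviation slice_hyperholomorphic :: "quat set \<Rightarrow> (quat \<Rightarrow> quat) \<Rightarrow> bool" where
  "slice_hyperholomorphic \<equiv> slice_polyanalytic 1"


section \<open>The polyanalytic Fueter map\<close>

definition poly_decomposition ::
  "nat \<Rightarrow> quat set \<Rightarrow> (quat \<Rightarrow> quat) \<Rightarrow> (nat \<Rightarrow> quat \<Rightarrow> quat) \<Rightarrow> bool" where
  "poly_decomposition m \<Omega> f fs \<longleftrightarrow>
     (\<forall>k<m. slice_hyperholomorphic \<Omega> (fs k)) \<and>
     (\<forall>q\<in>\<Omega>. f q = (\<Sum>k<m. qcnj q ^ k * fs k q))"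

text \<open>
  For \<open>f\<close> slice polyanalytic of order \<open>m\<close> on an axially symmetric slice domain \<open>\<Omega>\<close>, the
  components \<open>fs k\<close> with \<open>k < m\<close> exist and are unique as functions on \<open>\<Omega>\<close>. The choice
  operator only leaves open their values outside \<open>\<Omega>\<close> and the entries with \<open>k \<ge> m\<close>, which
  do not affect the map below at points of the open set \<open>\<Omega>\<close>.
\<close>

definition poly_components ::
  "nat \<Rightarrow> quat set \<Rightarrow> (quat \<Rightarrow> quat) \<Rightarrow> nat \<Rightarrow> quat \<Rightarrow> quat" where
  "poly_components m \<Omega> f = (SOME fs. poly_decomposition m \<Omega> f fs)"

text \<open>The map $\mathcal{C}_m$ on slice polyanalytic functions of order \<open>m\<close> on \<open>\<Omega>\<close>.\<close>

definition polyanalytic_fueter ::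
  "nat \<Rightarrow> quat set \<Rightarrow> (quat \<Rightarrow> quat) \<Rightarrow> quat \<Rightarrow> quat" where
  "polyanalytic_fueter m \<Omega> f q =
     (\<Sum>k<m. of_real (qRe q) ^ k * laplacian (poly_components m \<Omega> f k) q)"

definition Q_poly :: "nat \<Rightarrow> quat \<Rightarrow> quat" where
  "Q_poly s q =
     (\<Sum>j=0..s. of_real (2 * (real s - real j + 1) / ((real s + 1) * (real s + 2))) *
        q ^ (s - j) * qcnj q ^ j)"

end

theory Submission
  imports Defs
begin

text \<open>
  The decomposition $f = \sum_k \overline q^k f_k$ is unique: on each plane of \<open>I\<close> the operator
  $\partial_x + I\partial_y$ kills the $f_k$ and maps $\overline q^k f_k$ to
  $2k\,\overline q^{k-1} f_k$, which allows induction on the order. Hence the components of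
  $\overline q^k q^j$ are $q^j$ at index \<open>k\<close> and $0$ elsewhere, and only $\Delta(q^j)$ is left.
  With the Fueter operator $D = \sum_e e\,\partial_e$ one has
  $D(q^{j+1}) = -2 q^j + \overline q\,D(q^j)$ and $\Delta(q^{j+1}) = q\,\Delta(q^j) + 2 D(q^j)$.
\<close>

section \<open>Derivatives of powers in a noncommutative algebra\<close>

text \<open>The differential of p^j in direction v, that is, the sum of p^a v p^b over a + b = j -
  1. The recursion is the Leibniz rule for p * p^j, since v need not commute with p.\<close>

primrec pow_deriv :: "nat \<Rightarrow> 'a \<Rightarrow> 'a \<Rightarrow> 'a::real_normed_algebra_1" where
  "pow_deriv 0 v p = 0"
| "pow_deriv (Suc j) v p = v * p ^ j + p * pow_deriv j v p"

text \<open>The derivative of \<open>pow_deriv j v\<close> in direction u, read off by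
  differentiating its recursion.\<close>

primrec pow_deriv2 :: "nat \<Rightarrow> 'a \<Rightarrow> 'a \<Rightarrow> 'a \<Rightarrow> 'a::real_normed_algebra_1" where
  "pow_deriv2 0 v u p = 0"
| "pow_deriv2 (Suc j) v u p =
     v * pow_deriv j u p + (u * pow_deriv j v p + p * pow_deriv2 j v u p)"

lemma has_derivative_pow:
  "((\<lambda>p::'a::real_normed_algebra_1. p ^ j) has_derivative (\<lambda>v. pow_deriv j v p)) (at p)"
proof (induction j)
  case (Suc j)
  have "((\<lambda>p. p * p ^ j) has_derivative (\<lambda>v. p * pow_deriv j v p + v * p ^ j)) (at p)"
    by (rule has_derivative_mult[OF has_derivative_ident Suc])
  then show ?case
    by (simp add: add.commute)
qed simp

lemma has_derivative_pow_deriv: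
  "((\<lambda>p::'a::real_normed_algebra_1. pow_deriv j v p) has_derivative (\<lambda>u. pow_deriv2 j v u p)) (at p)"
proof (induction j)
  case (Suc j)
  have "((\<lambda>p. v * p ^ j + p * pow_deriv j v p) has_derivative
      (\<lambda>u. v * pow_deriv j u p + (p * pow_deriv2 j v u p + u * pow_deriv j v p))) (at p)"
    by (intro has_derivative_add has_derivative_mult_right has_derivative_pow
        has_derivative_mult[OF has_derivative_ident Suc])
  then show ?case
    by (simp add: add.commute)
qed simp

lemma linear_pow_deriv: "linear (\<lambda>v. pow_deriv j v p)"
  using has_derivative_linear[OF has_derivative_pow] .

text \<open>All summands p^a v p^b coincide, which restores the scalar power rule. At j = 0 the
  truncated exponent is masked by the factor 0.\<close>

lemma pow_deriv_commute:
  assumes "v * p = p * v"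
  shows "pow_deriv j v p = of_nat j * (v * p ^ (j - 1))"
proof (induction j)
  case (Suc j)
  have "p * (of_nat j * (v * p ^ (j - 1))) = of_nat j * (v * p ^ j)"
  proof (cases j)
    case (Suc i)
    have "p * (of_nat j * (v * p ^ i)) = of_nat j * (p * v * p ^ i)"
      by (metis mult.assoc mult_of_nat_commute)
    then show ?thesis
      using Suc by (simp add: assms[symmetric] mult.assoc)
  qed simp
  then show ?case
    using Suc by (simp add: algebra_simps)
qed simp

lemma dir_deriv_eq:
  assumes "(f has_derivative f') (at p)"
  shows "dir_deriv v f p = f' v"
proof -
  have "((\<lambda>t::real. p + t *\<^sub>R v) has_derivative (\<lambda>t. t *\<^sub>R v)) (at 0)"
    by (auto intro!: derivative_eq_intros)
  then have "((\<lambda>t. f (p + t *\<^sub>R v)) has_derivative (\<lambda>t. f' (t *\<^sub>R v))) (at 0)"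
    by (rule has_derivative_compose) (simp add: assms)
  then have "((\<lambda>t. f (p + t *\<^sub>R v)) has_vector_derivative f' v) (at 0)"
    by (simp add: has_vector_derivative_def linear_cmul[OF has_derivative_linear[OF assms]])
  then show ?thesis
    by (simp add: dir_deriv_def vector_derivative_at)
qed

lemma dir_deriv_pow: "dir_deriv v (\<lambda>p. p ^ j) = pow_deriv j v"
  by (rule ext) (rule dir_deriv_eq[OF has_derivative_pow])

lemma dir_deriv_pow_deriv: "dir_deriv u (pow_deriv j v) = pow_deriv2 j v u"
  by (rule ext) (rule dir_deriv_eq[OF has_derivative_pow_deriv])


section \<open>The Laplacian of a power\<close>

lemma of_real_quat: "of_real r = Quat r 0 0 0"
  by (simp add: of_real_def quat_eq_iff)

lemma quat_sel_numeral [simp]: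
  "qRe (numeral w) = numeral w" "qIm1 (numeral w) = 0"
  "qIm2 (numeral w) = 0" "qIm3 (numeral w) = 0"
proof -
  have "numeral w = Quat (numeral w) 0 0 0"
    by (metis of_real_numeral of_real_quat)
  then show "qRe (numeral w) = numeral w" "qIm1 (numeral w) = 0"
    "qIm2 (numeral w) = 0" "qIm3 (numeral w) = 0"
    by (metis quat.sel)+
qed

lemma qcnj_sel [simp]:
  "qRe (qcnj q) = qRe q" "qIm1 (qcnj q) = - qIm1 q"
  "qIm2 (qcnj q) = - qIm2 q" "qIm3 (qcnj q) = - qIm3 q"
  by (simp_all add: qcnj_def)

lemma qcnj_commute: "qcnj q * q = q * qcnj q"
  by (simp add: quat_eq_iff)

lemma sum_Basis_quat:
  "(\<Sum>e\<in>Basis. f e) = f 1 + f (Quat 0 1 0 0) + f (Quat 0 0 1 0) + f (Quat 0 0 0 1)"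
  by (simp add: Basis_quat_def one_quat_def add.assoc)

text \<open>
  For $e \in \{i, j, k\}$ one has $e q = \overline q e + 2\,\mathrm{Re}(e q)$, while
  $q = \overline q + 2\,\mathrm{Im}(q)$ for $e = 1$. The corrections sum to
  $2\,\mathrm{Im}(q)\,\partial_0 - 2\sum_{i\ge1} x_i\partial_i$, which vanishes on $q^j$
  because the Euler derivative $\sum_{i\ge0} x_i\partial_i q^j$ equals $q\,\partial_0 q^j$.
\<close>

lemma fueter_pow_twist:
  "(\<Sum>e\<in>Basis. e * (q * pow_deriv j e q)) = qcnj q * (\<Sum>e\<in>Basis. e * pow_deriv j e q)"
proof -
  define d where "d e = pow_deriv j e q" for e
  have lin: "linear d"
    using linear_pow_deriv unfolding d_def .
  have "q = qRe q *\<^sub>R 1 + qIm1 q *\<^sub>R Quat 0 1 0 0 + qIm2 q *\<^sub>R Quat 0 0 1 0 + qIm3 q *\<^sub>R Quat 0 0 0 1"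
    by (simp add: quat_eq_iff)
  then have "d q = d (qRe q *\<^sub>R 1 + qIm1 q *\<^sub>R Quat 0 1 0 0 + qIm2 q *\<^sub>R Quat 0 0 1 0
      + qIm3 q *\<^sub>R Quat 0 0 0 1)"
    by (rule arg_cong)
  also have "\<dots> = qRe q *\<^sub>R d 1 + qIm1 q *\<^sub>R d (Quat 0 1 0 0) + qIm2 q *\<^sub>R d (Quat 0 0 1 0)
      + qIm3 q *\<^sub>R d (Quat 0 0 0 1)"
    by (simp only: linear_add[OF lin] linear_cmul[OF lin])
  finally have euler: "d q = qRe q *\<^sub>R d 1 + qIm1 q *\<^sub>R d (Quat 0 1 0 0)
      + qIm2 q *\<^sub>R d (Quat 0 0 1 0) + qIm3 q *\<^sub>R d (Quat 0 0 0 1)" .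
  \<comment> \<open>Both \<open>q\<close> and \<open>1\<close> commute with \<open>q\<close>, so
    both sides equal j q^j.\<close>
  have "d q = q * d 1"
    by (cases j)
      (simp_all add: d_def pow_deriv_commute mult_of_nat_commute mult.assoc power_commutes distrib_left)
  with euler have "qRe q *\<^sub>R d 1 + qIm1 q *\<^sub>R d (Quat 0 1 0 0) + qIm2 q *\<^sub>R d (Quat 0 0 1 0)
      + qIm3 q *\<^sub>R d (Quat 0 0 0 1) = q * d 1"
    by simp
  then have "(\<Sum>e\<in>Basis. e * (q * d e)) = qcnj q * (\<Sum>e\<in>Basis. e * d e)"
    unfolding sum_Basis_quat quat_eq_iff by (simp add: algebra_simps)
  then show ?thesis
    by (simp add: d_def)
qed

text \<open>Each step of the recursion for D moves the earlier terms to the next power of the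
  conjugate and adds the new term i = 0.\<close>

lemma fueter_pow:
  "(\<Sum>e\<in>Basis. e * pow_deriv j e q) = - 2 * (\<Sum>i<j. q ^ (j - 1 - i) * qcnj q ^ i)"
proof (induction j)
  case (Suc j)
  have shift: "qcnj q * (q ^ (j - 1 - i) * qcnj q ^ i) = q ^ (j - Suc i) * qcnj q ^ Suc i" for i
    using power_commuting_commutes[OF qcnj_commute[symmetric], where n = "j - 1 - i"]
    by (simp flip: mult.assoc)
  have "(\<Sum>e\<in>Basis. e * pow_deriv (Suc j) e q)
      = (\<Sum>e\<in>Basis. e * e) * q ^ j + (\<Sum>e\<in>Basis. e * (q * pow_deriv j e q))"
    by (simp add: sum_distrib_right sum.distrib algebra_simps)
  \<comment> \<open>The squares of 1, i, j, k sum to 1 - 1 - 1 - 1.\<close>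
  also have "(\<Sum>e\<in>Basis. e * e) = (- 2 :: quat)"
    by (simp add: sum_Basis_quat quat_eq_iff)
  also have "(\<Sum>e\<in>Basis. e * (q * pow_deriv j e q))
      = - 2 * (\<Sum>i<j. q ^ (j - Suc i) * qcnj q ^ Suc i)"
  proof -
    have "qcnj q * (- 2 * T) = - 2 * (qcnj q * T)" for T
      by (simp add: mult_2 right_diff_distrib)
    then show ?thesis
      unfolding fueter_pow_twist Suc by (simp only: sum_distrib_left[of "qcnj q"] shift)
  qed
  finally show ?case
    by (simp add: sum.lessThan_Suc_shift algebra_simps del: sum.lessThan_Suc power_Suc)
qed simp

text \<open>In the recursion for the Laplacian, 2 D(q^j) is -4 times the unweighted sum of all
  monomials of degree j - 1, so passing from j to j + 1 raises every weight by one. For j \<le> 1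
  the sum is empty.\<close>

lemma laplacian_pow:
  "laplacian (\<lambda>p. p ^ j) q =
    - 4 * (\<Sum>i<j - 1. of_nat (j - 1 - i) * (q ^ (j - 2 - i) * qcnj q ^ i))"
proof -
  have lap: "laplacian (\<lambda>p. p ^ j) q = (\<Sum>e\<in>Basis. pow_deriv2 j e e q)" for j
    by (simp add: laplacian_def dir_deriv_pow dir_deriv_pow_deriv)
  define S where "S j = (\<Sum>i<j - 1. of_nat (j - 1 - i) * (q ^ (j - 2 - i) * qcnj q ^ i))" for j
  have S_Suc: "S (Suc j) = q * S j + (\<Sum>i<j. q ^ (j - 1 - i) * qcnj q ^ i)" for j
  proof -
    \<comment> \<open>For positive j the range grows from i < j - 1 to i < j at no cost: the added
      term i = j - 1 has weight 0.\<close>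
    have "q * S j = (\<Sum>i<j. of_nat (j - 1 - i) * (q ^ (j - 1 - i) * qcnj q ^ i))"
    proof (cases j)
      case (Suc m)
      have "q * (of_nat (m - i) * (q ^ (m - 1 - i) * qcnj q ^ i))
          = of_nat (m - i) * (q ^ (m - i) * qcnj q ^ i)" if "i < m" for i
      proof -
        have "q ^ (m - i) = q * q ^ (m - 1 - i)"
          using that by (simp flip: power_Suc add: Suc_diff_Suc)
        then show ?thesis
          by (metis mult.assoc mult_of_nat_commute)
      qed
      then show ?thesis
        by (simp add: Suc S_def sum_distrib_left)
    qed (simp add: S_def)
    then have "q * S j + (\<Sum>i<j. q ^ (j - 1 - i) * qcnj q ^ i)
        = (\<Sum>i<j. (of_nat (j - 1 - i) + 1) * (q ^ (j - 1 - i) * qcnj q ^ i))"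
      by (simp only: sum.distrib distrib_right mult_1_left)
    also have "\<dots> = (\<Sum>i<j. of_nat (j - i) * (q ^ (j - 1 - i) * qcnj q ^ i))"
    proof (rule sum.cong)
      fix i assume "i \<in> {..<j}"
      then have "j - i = Suc (j - 1 - i)" by auto
      then have "of_nat (j - i) = of_nat (j - 1 - i) + (1::quat)" by simp
      then show "(of_nat (j - 1 - i) + 1) * (q ^ (j - 1 - i) * qcnj q ^ i)
          = of_nat (j - i) * (q ^ (j - 1 - i) * qcnj q ^ i)" by simp
    qed simp
    finally show ?thesis
      by (simp add: S_def)
  qed
  have "(\<Sum>e\<in>Basis. pow_deriv2 j e e q) = - 4 * S j"
  proof (induction j)
    case (Suc j)
    \<comment> \<open>With both directions equal to e, the two mixed terms of
      \<open>pow_deriv2\<close> coincide, whence the factor 2.\<close>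
    have "(\<Sum>e\<in>Basis. pow_deriv2 (Suc j) e e q)
        = 2 * (\<Sum>e\<in>Basis. e * pow_deriv j e q) + q * (\<Sum>e\<in>Basis. pow_deriv2 j e e q)"
      by (simp add: sum.distrib sum_distrib_left mult_2 algebra_simps)
    also have "\<dots> = - 4 * (\<Sum>i<j. q ^ (j - 1 - i) * qcnj q ^ i) + q * (- 4 * S j)"
      unfolding fueter_pow Suc by (simp flip: mult.assoc)
    also have "q * (- 4 * S j) = - 4 * (q * S j)"
      by (simp add: quat_eq_iff)
    finally show ?case
      by (simp add: S_Suc algebra_simps)
  qed (simp add: S_def)
  then show ?thesis
    by (simp add: lap S_def)
qed

lemma laplacian_pow_Q:
  "laplacian (\<lambda>p. p ^ j) q =
    (if j = 0 \<or> j = 1 then 0 else of_real (- 2 * (real j - 1) * real j) * Q_poly (j - 2) q)"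
proof (cases "j = 0 \<or> j = 1")
  case False
  then obtain s where j: "j = Suc (Suc s)"
    by (metis One_nat_def not0_implies_Suc)
  have "of_real (- 2 * (real j - 1) * real j) *
      (of_real (2 * (real s - real i + 1) / ((real s + 1) * (real s + 2))) * q ^ (s - i) * qcnj q ^ i)
      = - 4 * (of_nat (j - 1 - i) * (q ^ (j - 2 - i) * qcnj q ^ i))" if "i \<le> s" for i
  proof -
    \<comment> \<open>Since j = s + 2, the factor (j - 1) j cancels the denominator (s + 1)(s + 2);
      \<open>i \<le> s\<close> makes the natural subtraction \<open>j - 1 - i\<close> exact.\<close>
    have "- 2 * (real j - 1) * real j * (2 * (real s - real i + 1) / ((real s + 1) * (real s + 2)))
        = - 4 * real (j - 1 - i)"
      using that by (simp add: j of_nat_diff divide_simps) (simp add: algebra_simps)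
    then have "of_real (- 2 * (real j - 1) * real j) *
        of_real (2 * (real s - real i + 1) / ((real s + 1) * (real s + 2)))
        = (of_real (- 4 * real (j - 1 - i)) :: quat)"
      by (simp only: flip: of_real_mult)
    also have "\<dots> = - 4 * of_nat (j - 1 - i)"
      by simp
    finally show ?thesis
      by (simp add: j mult.assoc[symmetric])
  qed
  then have "of_real (- 2 * (real j - 1) * real j) * Q_poly s q
      = (\<Sum>i=0..s. - 4 * (of_nat (j - 1 - i) * (q ^ (j - 2 - i) * qcnj q ^ i)))"
    by (simp add: Q_poly_def sum_distrib_left)
  also have "\<dots> = laplacian (\<lambda>p. p ^ j) q"
  proof -
    have "{..<j - 1} = {0..s}"
      by (auto simp: j)
    then show ?thesis
      by (simp only: laplacian_pow sum_distrib_left)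
  qed
  finally show ?thesis
    using False by (simp add: j)
qed (auto simp: laplacian_pow)


section \<open>Slice hyperholomorphy of powers\<close>

lemma imag_unit_square:
  assumes "I \<in> imag_units"
  shows "I * I = - 1"
  using assms by (simp add: imag_units_def power2_eq_square)

text \<open>Turns powers of the conjugate into powers of \<open>slice_pt (- I)\<close>, to which the
  derivative formulas for slice powers apply.\<close>

lemma qcnj_slice_pt:
  assumes "I \<in> imag_units"
  shows "qcnj (slice_pt I z) = slice_pt (- I) z"
proof -
  \<comment> \<open>Otherwise the imaginary components of I^2 = -1, which are 2 Re(I) times those of
    I, make I real with square -1.\<close>
  have "qRe I = 0"
  proof (rule ccontr)
    assume "qRe I \<noteq> 0"
    with imag_unit_square[OF assms] have "qIm1 I = 0" "qIm2 I = 0" "qIm3 I = 0" "qRe I * qRe I = - 1"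
      by (auto simp: quat_eq_iff)
    then show False
      using zero_le_square[of "qRe I"] by simp
  qed
  then show ?thesis
    by (cases z) (simp add: slice_pt_def of_real_quat quat_eq_iff)
qed

lemma ex_slice_pt: "\<exists>I\<in>imag_units. \<exists>z. q = slice_pt I z"
proof -
  define r where "r = sqrt ((qIm1 q)\<^sup>2 + (qIm2 q)\<^sup>2 + (qIm3 q)\<^sup>2)"
  have r2: "r * r = qIm1 q * qIm1 q + qIm2 q * qIm2 q + qIm3 q * qIm3 q"
    by (simp add: r_def power2_eq_square)
  show ?thesis
  proof (cases "r = 0")
    case True
    then have "qIm1 q = 0" "qIm2 q = 0" "qIm3 q = 0"
      by (simp_all add: r_def add_nonneg_eq_0_iff)
    \<comment> \<open>A real q lies in every plane, so any unit serves.\<close>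
    then have "q = slice_pt (Quat 0 1 0 0) (qRe q, 0)"
      by (simp add: slice_pt_def of_real_quat quat_eq_iff)
    moreover have "Quat 0 1 0 0 \<in> imag_units"
      by (simp add: imag_units_def power2_eq_square quat_eq_iff)
    ultimately show ?thesis by blast
  next
    case False
    \<comment> \<open>The normalised imaginary part of q, with r its length.\<close>
    define I where "I = Quat 0 (qIm1 q / r) (qIm2 q / r) (qIm3 q / r)"
    have "(qIm1 q * qIm1 q + qIm2 q * qIm2 q + qIm3 q * qIm3 q) / (r * r) = 1"
      using False by (simp flip: r2)
    then have "I \<in> imag_units"
      by (simp add: imag_units_def I_def power2_eq_square quat_eq_iff add_divide_distrib)
    moreover have "q = slice_pt I (qRe q, r)"
      using False by (simp add: I_def slice_pt_def of_real_quat quat_eq_iff)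
    ultimately show ?thesis by blast
  qed
qed

lemma has_derivative_slice_pt: "(slice_pt I has_derivative slice_pt I) (at z)"
  unfolding slice_pt_def case_prod_unfold
  by (auto intro!: derivative_eq_intros)

lemma slice_pt_commute: "slice_pt I z * I = I * slice_pt I z"
  by (cases z) (simp add: slice_pt_def quat_eq_iff of_real_quat algebra_simps)

lemma has_derivative_slice_pt_pow:
  "((\<lambda>z. slice_pt I z ^ j) has_derivative (\<lambda>w. pow_deriv j (slice_pt I w) (slice_pt I z))) (at z)"
  using has_derivative_compose[OF has_derivative_slice_pt has_derivative_pow] .

text \<open>The coordinate directions become 1 and I in the plane; both commute with its points, so
  the commuting power rule applies.\<close>

lemma dir_deriv_slice_pt_pow:
  "dir_deriv (1, 0) (\<lambda>z. slice_pt I z ^ j) z = of_nat j * slice_pt I z ^ (j - 1)"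
  "dir_deriv (0, 1) (\<lambda>z. slice_pt I z ^ j) z = of_nat j * (I * slice_pt I z ^ (j - 1))"
proof -
  have "slice_pt I (1, 0) = 1" "slice_pt I (0, 1) = I"
    by (simp_all add: slice_pt_def)
  then show
    "dir_deriv (1, 0) (\<lambda>z. slice_pt I z ^ j) z = of_nat j * slice_pt I z ^ (j - 1)"
    "dir_deriv (0, 1) (\<lambda>z. slice_pt I z ^ j) z = of_nat j * (I * slice_pt I z ^ (j - 1))"
    by (simp_all add: dir_deriv_eq[OF has_derivative_slice_pt_pow] pow_deriv_commute slice_pt_commute)
qed

text \<open>Because I^2 = -1, sending x + iy to x + Iy respects products. The two real parts do not
  depend on I, as a slice function requires.\<close>

lemma slice_pt_complex_power:
  assumes "I \<in> imag_units"
  shows "slice_pt I (x, y) ^ j = of_real (Re (Complex x y ^ j)) + I * of_real (Im (Complex x y ^ j))"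
proof (induction j)
  case (Suc j)
  have "(of_real x + I * of_real y) * (of_real a + I * of_real b)
      = of_real (x * a) + (I * I) * of_real (y * b) + I * of_real (x * b + y * a)" for a b
    by (simp add: quat_eq_iff of_real_quat algebra_simps)
  then show ?case
    by (simp add: Suc, simp add: slice_pt_def imag_unit_square[OF assms])
qed simp

lemma slice_hyperholomorphic_pow: "slice_hyperholomorphic UNIV (\<lambda>p. p ^ j)"
  unfolding slice_polyanalytic_def
proof (intro conjI ballI allI impI)
  \<comment> \<open>Conjugation symmetry makes the real part even and the imaginary part odd in
    y.\<close>
  have cnj: "Complex x (- y) ^ j = cnj (Complex x y ^ j)" for x y
    by (simp add: complex_cnj)
  show "slice_function UNIV (\<lambda>p. p ^ j)"
    unfolding slice_function_def
    by (rule exI[where x = "\<lambda>x y. of_real (Re (Complex x y ^ j)) :: quat"],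
        rule exI[where x = "\<lambda>x y. of_real (Im (Complex x y ^ j)) :: quat"])
      (simp add: slice_pt_complex_power cnj del: complex_cnj_power)
  have "frechet_derivative (\<lambda>p::quat. p ^ j) (at p) = (\<lambda>v. pow_deriv j v p)" for p
    using frechet_derivative_at[OF has_derivative_pow] by metis
  \<comment> \<open>\<open>Ck_on 1\<close> asks for continuity of the derivative in each fixed
    direction; a second differentiation provides it.\<close>
  moreover have "continuous_on UNIV (\<lambda>p::quat. pow_deriv j v p)" for v
    using has_derivative_pow_deriv has_derivative_continuous
    by (metis continuous_at_imp_continuous_on)
  ultimately show "Ck_on 1 UNIV (\<lambda>p::quat. p ^ j)"
    by (auto simp: One_nat_def intro: differentiableI[OF has_derivative_pow])
next
  fix I z assume I: "I \<in> imag_units"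
  \<comment> \<open>The product I * I = -1 makes the y-term cancel the x-derivative.\<close>
  have "I * (of_nat j * (I * slice_pt I z ^ (j - 1))) = of_nat j * (I * I * slice_pt I z ^ (j - 1))"
    by (metis mult.assoc mult_of_nat_commute)
  then show "(1 / 2 ^ 1) *\<^sub>R (slice_dbar I ^^ 1) ((\<lambda>p. p ^ j) \<circ> slice_pt I) z = 0"
    by (simp add: slice_dbar_def comp_def dir_deriv_slice_pt_pow imag_unit_square[OF I])
qed

lemma slice_hyperholomorphic_zero: "slice_hyperholomorphic UNIV (\<lambda>p. 0)"
proof -
  have d: "dir_deriv v (\<lambda>p. 0) = (\<lambda>p. 0)" for v :: "'a::real_normed_vector"
    by (rule ext) (rule dir_deriv_eq[OF has_derivative_const])
  have "slice_function UNIV (\<lambda>p. 0)"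
    unfolding slice_function_def by (intro exI[of _ "\<lambda>x y. 0"]) simp
  then show ?thesis
    by (simp add: slice_polyanalytic_def slice_dbar_def comp_def d)
qed


section \<open>Uniqueness of the polyanalytic decomposition\<close>

text \<open>Product rule with c = x - Iy: the x-derivative of c^k is k c^(k-1), and I times its
  y-derivative is the same because I (-I) = 1, giving 2k. In the other term I commutes with c^k,
  which comes out in front of the vanishing \<open>slice_dbar I h z\<close>.\<close>

lemma slice_dbar_conj_pow_mult:
  assumes I: "I \<in> imag_units" and h: "h differentiable (at z)" and "slice_dbar I h z = 0"
  shows "(\<lambda>z. slice_pt (- I) z ^ k * h z) differentiable (at z)"
    and "slice_dbar I (\<lambda>z. slice_pt (- I) z ^ k * h z) z
      = 2 * (of_nat k * (slice_pt (- I) z ^ (k - 1) * h z))"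
proof -
  define c where "c = slice_pt (- I) z"
  obtain h' where h': "(h has_derivative h') (at z)"
    using h by (auto simp: differentiable_def)
  note D = has_derivative_mult[OF has_derivative_slice_pt_pow[of "- I" k] h']
  then show "(\<lambda>z. slice_pt (- I) z ^ k * h z) differentiable (at z)"
    by (auto simp: differentiable_def)
  have dh: "h' (1, 0) + I * h' (0, 1) = 0"
    using assms(3) by (simp add: slice_dbar_def dir_deriv_eq[OF h'])
  have "slice_pt (- I) z * I = I * slice_pt (- I) z"
    using slice_pt_commute[of "- I" z] by simp
  then have comm: "I * c ^ i = c ^ i * I" for i
    unfolding c_def by (metis power_commuting_commutes)
  have e: "pow_deriv k (slice_pt (- I) (1, 0)) c = of_nat k * c ^ (k - 1)"
    "pow_deriv k (slice_pt (- I) (0, 1)) c = of_nat k * (- I * c ^ (k - 1))"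
    using dir_deriv_slice_pt_pow[of "- I" k z]
    unfolding dir_deriv_eq[OF has_derivative_slice_pt_pow] c_def by simp_all
  have "slice_dbar I (\<lambda>z. slice_pt (- I) z ^ k * h z) z
      = c ^ k * h' (1, 0) + of_nat k * c ^ (k - 1) * h z
        + I * (c ^ k * h' (0, 1) + of_nat k * (- I * c ^ (k - 1)) * h z)"
    by (simp add: slice_dbar_def dir_deriv_eq[OF D] e flip: c_def)
  also have "\<dots> = c ^ k * (h' (1, 0) + I * h' (0, 1)) + of_nat k * c ^ (k - 1) * h z
        - I * (of_nat k * (I * c ^ (k - 1))) * h z"
    using comm[of k] by (simp add: algebra_simps flip: mult.assoc)
  also have "I * (of_nat k * (I * c ^ (k - 1))) = of_nat k * (I * I * c ^ (k - 1))"
    by (metis mult.assoc mult_of_nat_commute)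
  finally show "slice_dbar I (\<lambda>z. slice_pt (- I) z ^ k * h z) z
      = 2 * (of_nat k * (slice_pt (- I) z ^ (k - 1) * h z))"
    by (simp add: dh imag_unit_square[OF I] mult_2 mult.assoc flip: c_def)
qed

lemma slice_dbar_sum:
  assumes "\<And>k. k \<in> A \<Longrightarrow> f k differentiable (at z)"
  shows "slice_dbar I (\<lambda>z. \<Sum>k\<in>A. f k z) z = (\<Sum>k\<in>A. slice_dbar I (f k) z)"
proof -
  obtain f' where f': "\<And>k. k \<in> A \<Longrightarrow> (f k has_derivative f' k) (at z)"
    using assms unfolding differentiable_def by metis
  have "dir_deriv v (\<lambda>z. \<Sum>k\<in>A. f k z) z = (\<Sum>k\<in>A. dir_deriv v (f k) z)" for v
    using dir_deriv_eq[OF has_derivative_sum[OF f']] dir_deriv_eq[OF f'] by simp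
  then show ?thesis
    by (simp add: slice_dbar_def sum.distrib sum_distrib_left)
qed

lemma slice_dbar_scaleR:
  assumes "h differentiable (at z)"
  shows "slice_dbar I (\<lambda>z. r *\<^sub>R h z) z = r *\<^sub>R slice_dbar I h z"
proof -
  obtain h' where h': "(h has_derivative h') (at z)"
    using assms by (auto simp: differentiable_def)
  show ?thesis
    by (simp add: slice_dbar_def dir_deriv_eq[OF h'] scaleR_add_right
        dir_deriv_eq[OF has_derivative_scaleR_right[OF h']])
qed

text \<open>Applying \<open>slice_dbar I\<close> to the vanishing sum kills the term k = 0 and
  lowers every other power by one, leaving a relation of length m among multiples of h 1, ..., h m.
  Once these vanish, the original relation reads h 0 = 0.\<close>

lemma slice_conj_powers_independent:
  assumes I: "I \<in> imag_units"
    and "\<And>k z. k < m \<Longrightarrow> h k differentiable (at z)"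
    and "\<And>k z. k < m \<Longrightarrow> slice_dbar I (h k) z = 0"
    and "\<And>z. (\<Sum>k<m. slice_pt (- I) z ^ k * h k z) = 0"
    and "k < m"
  shows "h k z = 0"
  using assms(2-)
proof (induction m arbitrary: h k z)
  case (Suc m)
  have higher: "h (Suc k) z = 0" if "k < m" for k z
  proof -
    \<comment> \<open>Absorbs the factor 2(k + 1) from differentiating the power k + 1; as a nonzero
      real scalar it commutes with \<open>slice_dbar I\<close> and can be cancelled
      afterwards.\<close>
    define g where "g k z = (2 * real (Suc k)) *\<^sub>R h (Suc k) z" for k z
    have "g k z = 0"
    proof (rule Suc.IH[OF _ _ _ that])
      fix k z assume "k < m"
      then have h: "h (Suc k) differentiable (at z)" "slice_dbar I (h (Suc k)) z = 0"
        using Suc.prems by auto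
      show "g k differentiable (at z)"
        unfolding g_def using h(1) by (intro derivative_intros) auto
      show "slice_dbar I (g k) z = 0"
        unfolding g_def by (simp only: slice_dbar_scaleR[OF h(1)] h(2) scaleR_zero_right)
    next
      fix z
      \<comment> \<open>The sum vanishes at every point, so it may replace the zero function under
        the derivative.\<close>
      have "0 = slice_dbar I (\<lambda>z. 0) z"
        by (simp add: slice_dbar_def dir_deriv_eq[OF has_derivative_const])
      also have "\<dots> = slice_dbar I (\<lambda>z. \<Sum>k<Suc m. slice_pt (- I) z ^ k * h k z) z"
        by (simp only: Suc.prems(3))
      also have "\<dots> = (\<Sum>k<Suc m. 2 * (of_nat k * (slice_pt (- I) z ^ (k - 1) * h k z)))"
        by (subst slice_dbar_sum)
          (auto intro!: sum.cong slice_dbar_conj_pow_mult[OF I] Suc.prems(1,2)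
            simp del: sum.lessThan_Suc One_nat_def)
      also have "\<dots> = (\<Sum>k<m. slice_pt (- I) z ^ k * g k z)"
      proof -
        have "2 * (of_nat (Suc k) * a) = (2 * real (Suc k)) *\<^sub>R a" for k and a :: quat
          by (simp only: scaleR_conv_of_real of_real_mult of_real_numeral of_real_of_nat_eq mult.assoc)
        then show ?thesis
          by (simp add: sum.lessThan_Suc_shift g_def del: sum.lessThan_Suc of_nat_Suc)
      qed
      finally show "(\<Sum>k<m. slice_pt (- I) z ^ k * g k z) = 0" ..
    qed
    then show ?thesis
      by (simp add: g_def)
  qed
  have "h 0 z = 0"
    using Suc.prems(3)[of z] by (simp add: sum.lessThan_Suc_shift higher del: sum.lessThan_Suc)
  then show ?case
    using higher Suc.prems(4) by (cases k) auto
qed simp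

lemma slice_hyperholomorphic_comp_slice_pt:
  assumes "slice_hyperholomorphic UNIV f" "I \<in> imag_units"
  shows "(f \<circ> slice_pt I) differentiable (at z)" "slice_dbar I (f \<circ> slice_pt I) z = 0"
proof -
  have "f differentiable (at (slice_pt I z))"
    using assms by (simp add: slice_polyanalytic_def)
  then show "(f \<circ> slice_pt I) differentiable (at z)"
    using differentiable_chain_at has_derivative_slice_pt by (metis differentiableI)
  show "slice_dbar I (f \<circ> slice_pt I) z = 0"
    using assms by (cases z) (simp add: slice_polyanalytic_def)
qed

text \<open>Every q lies in some plane, and there the differences of the components satisfy the
  hypotheses of \<open>slice_conj_powers_independent\<close>.\<close>

lemma poly_decomposition_unique:
  assumes f: "poly_decomposition m UNIV f fs" and g: "poly_decomposition m UNIV f gs" and "k < m"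
  shows "fs k = gs k"
proof
  fix q
  obtain I z where I: "I \<in> imag_units" and q: "q = slice_pt I z"
    using ex_slice_pt by blast
  define h where "h k z = (fs k \<circ> slice_pt I) z - (gs k \<circ> slice_pt I) z" for k z
  have "h k z = 0"
  proof (rule slice_conj_powers_independent[OF I _ _ _ \<open>k < m\<close>])
    fix k z assume "k < m"
    then have sh: "slice_hyperholomorphic UNIV (fs k)" "slice_hyperholomorphic UNIV (gs k)"
      using f g by (auto simp: poly_decomposition_def)
    note F = slice_hyperholomorphic_comp_slice_pt[OF sh(1) I, of z]
    note G = slice_hyperholomorphic_comp_slice_pt[OF sh(2) I, of z]
    obtain F' G' where F': "((fs k \<circ> slice_pt I) has_derivative F') (at z)"
      and G': "((gs k \<circ> slice_pt I) has_derivative G') (at z)"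
      using F(1) G(1) by (auto simp: differentiable_def)
    note D = has_derivative_diff[OF F' G']
    show "h k differentiable (at z)"
      using D by (auto simp: differentiable_def h_def[abs_def])
    have "slice_dbar I (h k) z = slice_dbar I (fs k \<circ> slice_pt I) z - slice_dbar I (gs k \<circ> slice_pt I) z"
      unfolding h_def[abs_def] slice_dbar_def dir_deriv_eq[OF D] dir_deriv_eq[OF F'] dir_deriv_eq[OF G']
      by (simp add: algebra_simps)
    then show "slice_dbar I (h k) z = 0"
      by (simp add: F(2) G(2))
  next
    fix z
    have "(\<Sum>k<m. qcnj (slice_pt I z) ^ k * fs k (slice_pt I z))
        = (\<Sum>k<m. qcnj (slice_pt I z) ^ k * gs k (slice_pt I z))"
      using f g by (metis UNIV_I poly_decomposition_def)
    then show "(\<Sum>k<m. slice_pt (- I) z ^ k * h k z) = 0"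
      by (simp add: h_def qcnj_slice_pt[OF I] right_diff_distrib sum_subtractf)
  qed
  then show "fs k q = gs k q"
    by (simp add: h_def q)
qed

text \<open>One explicit decomposition guarantees that the choice operator picks a genuine
  decomposition; uniqueness then identifies the two.\<close>

lemma poly_components_eq:
  assumes "poly_decomposition m UNIV f fs" "k < m"
  shows "poly_components m UNIV f k = fs k"
proof (rule poly_decomposition_unique[OF _ assms])
  show "poly_decomposition m UNIV f (poly_components m UNIV f)"
    unfolding poly_components_def by (rule someI[of "poly_decomposition m UNIV f", OF assms(1)])
qed

section \<open>Evaluation of the polyanalytic Fueter map on monomials\<close>

theorem theorem3p3:
  fixes n k j :: nat and q :: quat
  assumes "k \<le> n"
  shows "polyanalytic_fueter (n + 1) UNIV (\<lambda>p. qcnj p ^ k * p ^ j) q =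
    (if j = 0 \<or> j = 1 then 0
     else of_real (- 2 * (real j - 1) * real j * qRe q ^ k) * Q_poly (j - 2) q)"
proof -
  \<comment> \<open>The function is already in decomposed form; \<open>k \<le> n\<close> puts its
    only nonzero component in range.\<close>
  define fs :: "nat \<Rightarrow> quat \<Rightarrow> quat" where "fs i = (if i = k then (\<lambda>p. p ^ j) else (\<lambda>p. 0))" for i
  have kn: "k < n + 1"
    using assms by simp
  have "(\<Sum>i<n + 1. qcnj p ^ i * fs i p) = qcnj p ^ k * p ^ j" for p
  proof -
    have "(\<Sum>i<n + 1. qcnj p ^ i * fs i p) = (\<Sum>i<n + 1. if i = k then qcnj p ^ k * p ^ j else 0)"
      by (rule sum.cong) (auto simp: fs_def)
    then show ?thesis
      using kn by simp
  qed
  then have dec: "poly_decomposition (n + 1) UNIV (\<lambda>p. qcnj p ^ k * p ^ j) fs"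
    using slice_hyperholomorphic_pow slice_hyperholomorphic_zero
    by (simp add: poly_decomposition_def fs_def)
  have lap0: "laplacian (\<lambda>p. 0) q = 0"
    by (simp add: laplacian_def dir_deriv_def)
  have "polyanalytic_fueter (n + 1) UNIV (\<lambda>p. qcnj p ^ k * p ^ j) q
      = (\<Sum>i<n + 1. of_real (qRe q) ^ i * laplacian (fs i) q)"
    unfolding polyanalytic_fueter_def by (rule sum.cong) (simp_all only: poly_components_eq[OF dec] lessThan_iff)
  also have "\<dots> = (\<Sum>i<n + 1. if i = k then of_real (qRe q) ^ k * laplacian (\<lambda>p. p ^ j) q else 0)"
    by (rule sum.cong) (auto simp: fs_def lap0)
  also have "\<dots> = of_real (qRe q ^ k) * laplacian (\<lambda>p. p ^ j) q"
    using kn by simp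
  also have "\<dots> = (if j = 0 \<or> j = 1 then 0
     else of_real (- 2 * (real j - 1) * real j * qRe q ^ k) * Q_poly (j - 2) q)"
    unfolding laplacian_pow_Q
    by (simp only: mult_zero_right if_distrib[of "\<lambda>x. _ * x"] mult.commute[of _ "qRe q ^ k"]
        of_real_mult[of "qRe q ^ k"] mult.assoc[of "of_real (qRe q ^ k)"] cong: if_cong)
  finally show ?thesis .
qed

end
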